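(* Let $G$ be an interval graph with vertices $v_1,\ldots,v_n$ and an interval representation $I_G(v_i)=[a_i,b_i]$ with $b_1\le b_2\le\cdots\le b_n$, and let $A_{I_G}$ be the corresponding interval endpoints sequence. Consider the following procedure: start with $S=()$ and a flag set to false; scan $A_{I_G}$ from left to right; when the current element is a left endpoint $a_i$, set the flag to true; when the current element is a right endpoint $b_i$ and the flag is true, append $v_i$ to $S$ and set the flag to false; otherwise do nothing. Then the resulting sequence $S$ is a Grundy dominating sequence of $G$. In addition, for any interval representation $I_G$ of $G$, $\gamma_{gr}(G)$ equals the number of pairs of consecutive entries of $A_{I_G}$ of the form $(a_i,b_j)$ (a left endpoint immediately followed by a right endpoint).
   Context: An interval graph is a graph admitting an interval representation: an assignment of closed real intervals to vertices such that two vertices are adjacent iff their intervals intersect. Given the representation $I_G(v_i)=[a_i,b_i]$, the interval endpoints sequence $A_{I_G}$ is the non-decreasing sequence of length $2n$ listing all the numbers $a_1,b_1,\ldots,a_n,b_n$ (as a multiset), where whenever $a_i=b_j$ the entry $a_i$ is placed before $b_j$; each entry is remembered as being the left endpoint $a_i$ or the right endpoint $b_i$ of a specific vertex. For a vertex $v$, $N[v]$ is its closed neighborhood. A sequence $(x_1,\ldots,x_k)$ of distinct vertices is legal if $N[x_i]\setminus\bigcup_{j<i}N[x_j]\neq\emptyset$ for all $i$, and dominating if moreover $\{x_1,\ldots,x_k\}$ dominates $G$. $\gamma_{gr}(G)$ is the maximum length of a legal dominating sequence; one of that length is a Grundy dominating sequence. *)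

theory Defs
  imports Complex_Main "Graph_Theory.Pair_Digraph"
begin

text \<open>
  Finite simple undirected graphs are the structures \<open>G\<close> satisfying \<^locale>\<open>pair_graph\<close>
  (finite, symmetric, loop-free; the null graph is not excluded).
\<close>

definition adjacent :: "'a pair_pre_digraph \<Rightarrow> 'a \<Rightarrow> 'a \<Rightarrow> bool" where
  "adjacent G u w \<longleftrightarrow> (u, w) \<in> parcs G"

definition closed_nbhd :: "'a pair_pre_digraph \<Rightarrow> 'a \<Rightarrow> 'a set" where
  "closed_nbhd G w = insert w {u. adjacent G w u}"

definition legal_seq :: "'a pair_pre_digraph \<Rightarrow> 'a list \<Rightarrow> bool" where
  "legal_seq G xs \<longleftrightarrow> set xs \<subseteq> pverts G \<and> distinct xs \<and>
     (\<forall>i<length xs. closed_nbhd G (xs ! i) - (\<Union>j<i. closed_nbhd G (xs ! j)) \<noteq> {})"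

definition dominating_set :: "'a pair_pre_digraph \<Rightarrow> 'a set \<Rightarrow> bool" where
  "dominating_set G D \<longleftrightarrow> D \<subseteq> pverts G \<and>
     (\<forall>u \<in> pverts G - D. \<exists>d\<in>D. adjacent G u d)"

definition legal_dominating_seq :: "'a pair_pre_digraph \<Rightarrow> 'a list \<Rightarrow> bool" where
  "legal_dominating_seq G xs \<longleftrightarrow> legal_seq G xs \<and> dominating_set G (set xs)"

definition grundy_domination_number :: "'a pair_pre_digraph \<Rightarrow> nat" where
  "grundy_domination_number G = Max {length xs | xs. legal_dominating_seq G xs}"

definition grundy_dominating_seq :: "'a pair_pre_digraph \<Rightarrow> 'a list \<Rightarrow> bool" where
  "grundy_dominating_seq G xs \<longleftrightarrow>
     legal_dominating_seq G xs \<and> length xs = grundy_domination_number G"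

text \<open>The representation assigns to \<open>u\<close> the closed interval \<open>{a u..b u}\<close>, which may be a point
  but not empty.\<close>

definition interval_representation ::
    "'a pair_pre_digraph \<Rightarrow> ('a \<Rightarrow> real) \<Rightarrow> ('a \<Rightarrow> real) \<Rightarrow> bool" where
  "interval_representation G a b \<longleftrightarrow>
     (\<forall>u\<in>pverts G. a u \<le> b u) \<and>
     (\<forall>u\<in>pverts G. \<forall>w\<in>pverts G. u \<noteq> w \<longrightarrow>
        (adjacent G u w \<longleftrightarrow> {a u..b u} \<inter> {a w..b w} \<noteq> {}))"

definition interval_graph :: "'a pair_pre_digraph \<Rightarrow> bool" where
  "interval_graph G \<longleftrightarrow> pair_graph G \<and> (\<exists>a b. interval_representation G a b)"

text \<open>Entries of the endpoints sequence are labelled by side and vertex, so that numerically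
  equal endpoints remain distinguishable.\<close>

datatype 'a endpoint = LeftEnd 'a | RightEnd 'a

fun endpoint_value :: "('a \<Rightarrow> real) \<Rightarrow> ('a \<Rightarrow> real) \<Rightarrow> 'a endpoint \<Rightarrow> real" where
  "endpoint_value a b (LeftEnd u) = a u"
| "endpoint_value a b (RightEnd u) = b u"

text \<open>Every endpoint occurs exactly once, hence the length is twice the number of vertices.
  The order among equal left endpoints, and among equal right endpoints, is left open;
  hence a predicate rather than a function.\<close>

definition endpoints_sequence ::
    "'a pair_pre_digraph \<Rightarrow> ('a \<Rightarrow> real) \<Rightarrow> ('a \<Rightarrow> real) \<Rightarrow> 'a endpoint list \<Rightarrow> bool" where
  "endpoints_sequence G a b A \<longleftrightarrow>
     distinct A \<and> set A = LeftEnd ` pverts G \<union> RightEnd ` pverts G \<and>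
     sorted (map (endpoint_value a b) A) \<and>
     (\<forall>i<length A. \<forall>j<length A. \<forall>u w.
        A ! i = LeftEnd u \<and> A ! j = RightEnd w \<and> a u = b w \<longrightarrow> i < j)"

text \<open>The state of the scan is the sequence built so far together with the flag.\<close>

fun scan_step :: "'a endpoint \<Rightarrow> 'a list \<times> bool \<Rightarrow> 'a list \<times> bool" where
  "scan_step (LeftEnd u) (S, flag) = (S, True)"
| "scan_step (RightEnd u) (S, flag) = (if flag then (S @ [u], False) else (S, flag))"

definition scan_result :: "'a endpoint list \<Rightarrow> 'a list" where
  "scan_result A = fst (fold scan_step A ([], False))"

definition left_right_positions :: "'a endpoint list \<Rightarrow> nat set" where
  "left_right_positions A =
     {k. Suc k < length A \<and> (\<exists>u w. A ! k = LeftEnd u \<and> A ! Suc k = RightEnd w)}"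

end

theory Submission
  imports Defs
begin

text \<open>
  Call an entry pair (left endpoint, right endpoint) in consecutive positions a \<^emph>\<open>peak\<close>. Two intervals
  meet iff they both span a common peak. In a legal sequence choose for each vertex \<open>x\<close> a footprint \<open>u\<close>
  and a peak spanned by \<open>x\<close> and \<open>u\<close>: these peaks are distinct, as otherwise \<open>u\<close> would already
  be dominated. Conversely the right endpoints of the peaks, which are what the scan
  collects, form a legal sequence, the left endpoint of each peak being the footprint, and dominate
  because every interval spans a peak.
\<close>

section \<open>Peaks and the output of the scan\<close>

lemma left_right_positions_less: "k \<in> left_right_positions A \<Longrightarrow> Suc k < length A"
  by (simp add: left_right_positions_def)

lemma finite_left_right_positions [simp]: "finite (left_right_positions A)"
  by (rule finite_subset[of _ "{..<length A}"]) (auto simp: left_right_positions_def)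

lemma left_right_positions_Nil [simp]: "left_right_positions [] = {}"
  by (simp add: left_right_positions_def)

text \<open>Appending one entry creates only one new consecutive pair, the last old entry followed
  by \<open>x\<close>. This recursion follows the direction of the scan.\<close>

lemma left_right_positions_snoc:
  "left_right_positions (A @ [x]) = left_right_positions A \<union>
     (if A \<noteq> [] \<and> (\<exists>u. last A = LeftEnd u) \<and> (\<exists>w. x = RightEnd w) then {length A - 1} else {})"
proof (cases A rule: rev_cases)
  case Nil
  then show ?thesis by (auto simp: left_right_positions_def)
next
  case (snoc B y)
  then show ?thesis
    by (auto simp: left_right_positions_def nth_append less_Suc_eq split: if_splits)
qed

fun endpoint_vertex :: "'a endpoint \<Rightarrow> 'a" where
  "endpoint_vertex (LeftEnd u) = u"
| "endpoint_vertex (RightEnd u) = u"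

text \<open>Every right endpoint leaves the flag false and every left endpoint sets it, so the flag
  records whether the last entry read was a left endpoint. Hence a vertex is appended exactly when a
  peak is completed.\<close>

lemma fold_scan_step:
  "fold scan_step A ([], False) =
     (map (\<lambda>k. endpoint_vertex (A ! Suc k)) (sorted_list_of_set (left_right_positions A)),
      A \<noteq> [] \<and> (\<exists>u. last A = LeftEnd u))"
proof (induction A rule: rev_induct)
  case Nil
  then show ?case by simp
next
  case (snoc x A)
  let ?f = "\<lambda>A k. endpoint_vertex (A ! Suc k)"
  let ?ks = "sorted_list_of_set (left_right_positions A)"
  have old: "map (?f (A @ [x])) ?ks = map (?f A) ?ks"
    by (auto simp: nth_append dest: left_right_positions_less)
  show ?case
  proof (cases "A \<noteq> [] \<and> (\<exists>u. last A = LeftEnd u) \<and> (\<exists>w. x = RightEnd w)")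
    case True
    then have eq: "left_right_positions (A @ [x]) = insert (length A - 1) (left_right_positions A)"
      by (simp add: left_right_positions_snoc)
    have less: "k < length A - 1" if "k \<in> left_right_positions A" for k
      using left_right_positions_less[OF that] by simp
    \<comment> \<open>The new peak lies to the right of all earlier ones, so in sorted order it goes
      to the end, just as the scan appends its vertex.\<close>
    then have "sorted_list_of_set (left_right_positions (A @ [x])) = ?ks @ [length A - 1]"
      unfolding eq
      by (subst sorted_list_of_set_unique[symmetric])
         (auto simp: sorted_wrt_append card_insert_if)
    with True snoc old show ?thesis by auto
  next
    case False
    then have "left_right_positions (A @ [x]) = left_right_positions A"
      by (simp only: left_right_positions_snoc if_False Un_empty_right)
    with False snoc old show ?thesis by (cases x) auto
  qed
qed

lemma scan_result_eq:
  "scan_result A =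
     map (\<lambda>k. endpoint_vertex (A ! Suc k)) (sorted_list_of_set (left_right_positions A))"
  by (simp add: scan_result_def fold_scan_step)

lemma length_scan_result: "length (scan_result A) = card (left_right_positions A)"
  by (simp add: scan_result_eq)

text \<open>Walking left from \<open>j\<close>, the first left endpoint met starts a peak. The walk
  stops at \<open>i\<close> at the latest.\<close>

lemma left_right_position_between:
  assumes "i < j" "j < length A" "A ! i = LeftEnd u" "A ! j = RightEnd w"
  shows "\<exists>k\<in>left_right_positions A. i \<le> k \<and> k < j"
  using assms
proof (induction j arbitrary: w)
  case 0
  then show ?case by simp
next
  case (Suc j)
  show ?case
  proof (cases "A ! j")
    case (LeftEnd x)
    with Suc.prems show ?thesis
      by (intro bexI[of _ j]) (auto simp: left_right_positions_def)
  next
    case (RightEnd x)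
    with Suc.prems have "i < j" by (cases "i = j") auto
    with Suc.IH[OF _ _ _ RightEnd] Suc.prems show ?thesis by (auto intro: less_SucI)
  qed
qed

section \<open>Intervals that span a peak\<close>

definition spans :: "'a endpoint list \<Rightarrow> nat \<Rightarrow> 'a \<Rightarrow> bool" where
  "spans A k u \<longleftrightarrow>
     (\<exists>i\<le>k. A ! i = LeftEnd u) \<and> (\<exists>j>k. j < length A \<and> A ! j = RightEnd u)"

text \<open>The sequence \<open>A\<close> is a parameter because ties among endpoints of the same
  side may allow several sequences for one representation.\<close>

locale represented_graph =
  fixes G :: "'a pair_pre_digraph" and a b :: "'a \<Rightarrow> real" and A :: "'a endpoint list"
  assumes graph: "pair_graph G"
    and rep: "interval_representation G a b"
    and seq: "endpoints_sequence G a b A"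
begin

text \<open>Two closed intervals meet iff each starts no later than the other ends. For
  \<open>u = w\<close> the right-hand side is \<open>a u \<le> b u\<close>, which matches the closed
  neighborhood.\<close>

lemma closed_nbhd_iff:
  assumes "u \<in> pverts G" "w \<in> pverts G"
  shows "u \<in> closed_nbhd G w \<longleftrightarrow> a u \<le> b w \<and> a w \<le> b u"
  using rep assms unfolding interval_representation_def closed_nbhd_def by fastforce

text \<open>Sortedness settles the case of distinct values. If the values are equal, the rule that
  left endpoints precede right ones decides, so positions capture the intersection of closed
  intervals exactly.\<close>

lemma left_before_right_iff:
  assumes "i < length A" "j < length A" "A ! i = LeftEnd u" "A ! j = RightEnd w"
  shows "i < j \<longleftrightarrow> a u \<le> b w"
proof
  assume "i < j"
  with seq assms show "a u \<le> b w"
    using sorted_nth_mono[of "map (endpoint_value a b) A" i j]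
    by (auto simp: endpoints_sequence_def)
next
  assume le: "a u \<le> b w"
  show "i < j"
  proof (rule ccontr)
    assume "\<not> i < j"
    with seq assms have "b w \<le> a u"
      using sorted_nth_mono[of "map (endpoint_value a b) A" j i]
      by (auto simp: endpoints_sequence_def)
    with le have "a u = b w" by simp
    with seq assms \<open>\<not> i < j\<close> show False
      unfolding endpoints_sequence_def by blast
  qed
qed

lemma obtain_positions:
  assumes "u \<in> pverts G"
  obtains i j where "i < j" "j < length A" "A ! i = LeftEnd u" "A ! j = RightEnd u"
proof -
  from seq assms have "LeftEnd u \<in> set A" "RightEnd u \<in> set A"
    by (auto simp: endpoints_sequence_def)
  then obtain i j where ij: "i < length A" "A ! i = LeftEnd u" "j < length A" "A ! j = RightEnd u"
    by (auto simp: in_set_conv_nth)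
  moreover have "a u \<le> b u" using rep assms by (simp add: interval_representation_def)
  ultimately show thesis using that left_before_right_iff by blast
qed

lemma entry_in_pverts:
  "i < length A \<Longrightarrow> endpoint_vertex (A ! i) \<in> pverts G"
  using seq nth_mem[of i A] by (auto simp: endpoints_sequence_def)

lemma nth_eq_iff: "i < length A \<Longrightarrow> j < length A \<Longrightarrow> A ! i = A ! j \<longleftrightarrow> i = j"
  using seq by (simp add: endpoints_sequence_def nth_eq_iff_index_eq)

lemma spans_left:
  assumes "k < length A" "A ! k = LeftEnd u"
  shows "spans A k u"
proof -
  have "u \<in> pverts G" using entry_in_pverts[OF assms(1)] assms(2) by simp
  then obtain i j where "i < j" "j < length A" "A ! i = LeftEnd u" "A ! j = RightEnd u"
    by (rule obtain_positions)
  \<comment> \<open>Entries of \<open>A\<close> are distinct, so \<open>i = k\<close> and the right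
    endpoint lies beyond \<open>k\<close>.\<close>
  with assms nth_eq_iff[of i k] show ?thesis unfolding spans_def by auto
qed

lemma spans_right:
  assumes "Suc k < length A" "A ! Suc k = RightEnd u"
  shows "spans A k u"
proof -
  have "u \<in> pverts G" using entry_in_pverts[OF assms(1)] assms(2) by simp
  then obtain i j where "i < j" "j < length A" "A ! i = LeftEnd u" "A ! j = RightEnd u"
    by (rule obtain_positions)
  with assms nth_eq_iff[of j "Suc k"] have "i \<le> k" by auto
  with \<open>A ! i = LeftEnd u\<close> assms show ?thesis unfolding spans_def by blast
qed

text \<open>If the intervals meet, both left endpoints precede both right endpoints, and a peak lies
  between the later left and the earlier right endpoint. Conversely, a common peak puts each left
  endpoint before the other's right endpoint.\<close>

lemma closed_nbhd_iff_spans: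
  assumes V: "u \<in> pverts G" "w \<in> pverts G"
  shows "u \<in> closed_nbhd G w \<longleftrightarrow> (\<exists>k\<in>left_right_positions A. spans A k u \<and> spans A k w)"
proof
  assume "u \<in> closed_nbhd G w"
  then have le: "a u \<le> b w" "a w \<le> b u" using V closed_nbhd_iff by auto
  from V obtain i j where u: "i < j" "j < length A" "A ! i = LeftEnd u" "A ! j = RightEnd u"
    by (auto elim: obtain_positions)
  from V obtain i' j' where w: "i' < j'" "j' < length A" "A ! i' = LeftEnd w" "A ! j' = RightEnd w"
    by (auto elim: obtain_positions)
  have "i < j'" "i' < j"
    using le u w left_before_right_iff[of i j' u w] left_before_right_iff[of i' j w u] by simp_all
  \<comment> \<open>These two positions delimit the intersection of the two intervals.\<close>
  then have lt: "max i i' < min j j'" "min j j' < length A" using u(1,2) w(1,2) by simp_all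
  obtain x where x: "A ! max i i' = LeftEnd x" using u(3) w(3) by (metis max_def)
  obtain y where y: "A ! min j j' = RightEnd y" using u(4) w(4) by (metis min_def)
  obtain k where "k \<in> left_right_positions A" "max i i' \<le> k" "k < min j j'"
    using left_right_position_between[OF lt x y] by blast
  then have "k \<in> left_right_positions A" "i \<le> k" "i' \<le> k" "k < j" "k < j'" by simp_all
  with u w show "\<exists>k\<in>left_right_positions A. spans A k u \<and> spans A k w"
    unfolding spans_def by blast
next
  assume "\<exists>k\<in>left_right_positions A. spans A k u \<and> spans A k w"
  then obtain k i j i' j' where
    "i \<le> k" "A ! i = LeftEnd u" "k < j" "j < length A" "A ! j = RightEnd u"
    "i' \<le> k" "A ! i' = LeftEnd w" "k < j'" "j' < length A" "A ! j' = RightEnd w"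
    unfolding spans_def by blast
  then have "a u \<le> b w" "a w \<le> b u"
    using left_before_right_iff[of i j' u w] left_before_right_iff[of i' j w u] by auto
  with V closed_nbhd_iff show "u \<in> closed_nbhd G w" by simp
qed

lemma closed_nbhd_subset: "w \<in> pverts G \<Longrightarrow> closed_nbhd G w \<subseteq> pverts G"
proof -
  interpret pair_graph G by (rule graph)
  show "w \<in> pverts G \<Longrightarrow> closed_nbhd G w \<subseteq> pverts G"
    by (auto simp: closed_nbhd_def adjacent_def dest: in_arcsD2)
qed

section \<open>Upper bound by the number of peaks\<close>

lemma length_legal_seq_le:
  assumes "legal_seq G xs"
  shows "length xs \<le> card (left_right_positions A)"
proof -
  have in_V: "xs ! i \<in> pverts G" if "i < length xs" for i
    using assms nth_mem[OF that] unfolding legal_seq_def by blast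
  have "\<exists>u k. u \<in> pverts G \<and> k \<in> left_right_positions A \<and> spans A k u \<and> spans A k (xs ! i) \<and>
          (\<forall>j<i. u \<notin> closed_nbhd G (xs ! j))" if i: "i < length xs" for i
  proof -
    have "closed_nbhd G (xs ! i) - (\<Union>j<i. closed_nbhd G (xs ! j)) \<noteq> {}"
      using assms i unfolding legal_seq_def by (elim conjE allE[of _ i]) (rule mp)
    then obtain u where u: "u \<in> closed_nbhd G (xs ! i)" "\<forall>j<i. u \<notin> closed_nbhd G (xs ! j)"
      by blast
    have V: "u \<in> pverts G" using closed_nbhd_subset[OF in_V[OF i]] u(1) by blast
    with u closed_nbhd_iff_spans[OF V in_V[OF i]] show ?thesis by blast
  qed
  \<comment> \<open>Here \<open>f i\<close> is a footprint of the \<open>i\<close>-th vertex and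
    \<open>p i\<close> a peak that both span.\<close>
  then obtain f p where fp: "\<And>i. i < length xs \<Longrightarrow> f i \<in> pverts G \<and> p i \<in> left_right_positions A \<and>
      spans A (p i) (f i) \<and> spans A (p i) (xs ! i) \<and> (\<forall>j<i. f i \<notin> closed_nbhd G (xs ! j))"
    by metis
  have "p i \<noteq> p j" if ij: "i < j" "j < length xs" for i j
  proof
    assume eq: "p i = p j"
    have i: "i < length xs" using ij by simp
    from eq fp[OF i] fp[OF ij(2)]
    have V: "f j \<in> pverts G" and "spans A (p i) (f j)" "spans A (p i) (xs ! i)"
      "p i \<in> left_right_positions A" by simp_all
    \<comment> \<open>A shared peak makes the later footprint a closed neighbor of the earlier
      vertex, against its choice.\<close>
    then have "f j \<in> closed_nbhd G (xs ! i)"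
      using closed_nbhd_iff_spans[OF V in_V[OF i]] by blast
    then show False using fp[OF ij(2)] ij(1) by blast
  qed
  then have "inj_on p {..<length xs}"
    by (intro linorder_inj_onI) auto
  moreover have "p ` {..<length xs} \<subseteq> left_right_positions A" using fp by blast
  ultimately show ?thesis using card_inj_on_le[of p "{..<length xs}"] by simp
qed

section \<open>The scan attains the bound\<close>

lemma legal_seq_scan_result: "legal_seq G (scan_result A)"
proof -
  let ?ks = "sorted_list_of_set (left_right_positions A)"
  let ?S = "scan_result A"
  have ks: "Suc (?ks ! i) < length A \<and>
      (\<exists>u. A ! (?ks ! i) = LeftEnd u) \<and> A ! Suc (?ks ! i) = RightEnd (?S ! i)"
    if "i < length ?S" for i
  proof -
    have "?ks ! i \<in> left_right_positions A"
      using that nth_mem[of i ?ks] by (simp add: length_scan_result)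
    then show ?thesis
      using that by (auto simp: left_right_positions_def scan_result_eq)
  qed
  have less: "?ks ! i < ?ks ! j" if "i < j" "j < length ?S" for i j
    using that sorted_wrt_nth_less[OF strict_sorted_list_of_set] by (simp add: length_scan_result)
  have in_V: "?S ! i \<in> pverts G" if "i < length ?S" for i
    using ks[OF that] entry_in_pverts[of "Suc (?ks ! i)"] by simp
  have footprint: "\<exists>u. u \<in> closed_nbhd G (?S ! i) \<and> (\<forall>j<i. u \<notin> closed_nbhd G (?S ! j))"
    if i: "i < length ?S" for i
  proof -
    from ks[OF i] obtain u where u: "A ! (?ks ! i) = LeftEnd u" by auto
    have V: "u \<in> pverts G" using ks[OF i] u entry_in_pverts[of "?ks ! i"] by simp
    have "?ks ! i \<in> left_right_positions A" using ks[OF i] by (auto simp: left_right_positions_def)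
    then have "u \<in> closed_nbhd G (?S ! i)"
      using spans_left[OF _ u] spans_right[of "?ks ! i" "?S ! i"] ks[OF i] V in_V[OF i]
        closed_nbhd_iff_spans Suc_lessD by blast
    moreover have "u \<notin> closed_nbhd G (?S ! j)" if "j < i" for j
    proof -
      have j: "j < length ?S" using that i by simp
      \<comment> \<open>The earlier peak ends at position \<open>Suc (?ks ! j)\<close>, which is at
        most \<open>?ks ! i\<close>; thus the interval of \<open>u\<close> starts strictly after the
        one of \<open>?S ! j\<close> has ended.\<close>
      have "\<not> ?ks ! i < Suc (?ks ! j)" using less[OF that i] by simp
      then have "\<not> a u \<le> b (?S ! j)"
        using left_before_right_iff[of "?ks ! i" "Suc (?ks ! j)" u "?S ! j"] ks[OF i] ks[OF j] u
        by auto
      then show ?thesis using V in_V[OF j] closed_nbhd_iff by blast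
    qed
    ultimately show ?thesis by blast
  qed
  have "?S ! i \<noteq> ?S ! j" if "i < j" "j < length ?S" for i j
    \<comment> \<open>A repeated vertex would already cover its own later footprint.\<close>
    using footprint[OF that(2)] that(1) by metis
  then have "distinct ?S"
    by (metis distinct_conv_nth nat_neq_iff)
  then show ?thesis
    unfolding legal_seq_def using in_V footprint by (fastforce simp: in_set_conv_nth)
qed

lemma dominating_scan_result: "dominating_set G (set (scan_result A))"
  unfolding dominating_set_def
proof (intro conjI ballI)
  show "set (scan_result A) \<subseteq> pverts G"
    using legal_seq_scan_result by (simp add: legal_seq_def)
next
  fix u assume u: "u \<in> pverts G - set (scan_result A)"
  then have "u \<in> closed_nbhd G u" by (simp add: closed_nbhd_def)
  \<comment> \<open>Applying the peak criterion to \<open>u\<close> and itself shows that its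
    interval spans some peak; the vertex whose right endpoint closes that peak is collected by the
    scan and meets \<open>u\<close>.\<close>
  with u obtain k where k: "k \<in> left_right_positions A" "spans A k u"
    using closed_nbhd_iff_spans by blast
  then obtain w where w: "Suc k < length A" "A ! Suc k = RightEnd w"
    by (auto simp: left_right_positions_def)
  have "w \<in> set (scan_result A)"
    using k w by (force simp: scan_result_eq)
  moreover have "w \<in> pverts G" using w entry_in_pverts[of "Suc k"] by simp
  then have "w \<in> closed_nbhd G u"
    using u k spans_right[OF w] closed_nbhd_iff_spans by blast
  ultimately show "\<exists>d\<in>set (scan_result A). adjacent G u d"
    using u by (auto simp: closed_nbhd_def)
qed

lemma legal_dominating_scan_result: "legal_dominating_seq G (scan_result A)"
  by (simp add: legal_dominating_seq_def legal_seq_scan_result dominating_scan_result)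

lemma grundy_domination_number_eq:
  "grundy_domination_number G = card (left_right_positions A)"
  unfolding grundy_domination_number_def
proof (rule Max_eqI)
  let ?L = "{length xs | xs. legal_dominating_seq G xs}"
  have le: "n \<le> card (left_right_positions A)" if "n \<in> ?L" for n
    using that length_legal_seq_le by (auto simp: legal_dominating_seq_def)
  then show "n \<le> card (left_right_positions A)" if "n \<in> ?L" for n
    using that by blast
  \<comment> \<open>\<open>Max\<close> is meaningful only on a finite set; finiteness follows from
    the upper bound on lengths of legal sequences.\<close>
  show "finite ?L"
    by (rule finite_subset[of _ "{..card (left_right_positions A)}"]) (use le in blast)+
  show "card (left_right_positions A) \<in> ?L"
    using legal_dominating_scan_result length_scan_result[of A, symmetric] by blast
qed

end

theorem theorem4p1:
  fixes G :: "'a pair_pre_digraph"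
  assumes "interval_graph G"
  shows "(\<forall>(n :: nat) (v :: nat \<Rightarrow> 'a) a b A.
            bij_betw v {1..n} (pverts G) \<and>
            interval_representation G a b \<and>
            (\<forall>i j. 1 \<le> i \<and> i \<le> j \<and> j \<le> n \<longrightarrow> b (v i) \<le> b (v j)) \<and>
            endpoints_sequence G a b A \<longrightarrow>
            grundy_dominating_seq G (scan_result A)) \<and>
         (\<forall>a b A.
            interval_representation G a b \<and> endpoints_sequence G a b A \<longrightarrow>
            grundy_domination_number G = card (left_right_positions A))"
proof -
  \<comment> \<open>Both claims rest on this fact about an arbitrary representation; the first also
    uses that the scan returns one vertex per peak.\<close>
  have "grundy_domination_number G = card (left_right_positions A) \<and>
      legal_dominating_seq G (scan_result A)"
    if "interval_representation G a b" "endpoints_sequence G a b A" for a b A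
  proof -
    interpret represented_graph G a b A
      using assms that by (simp add: interval_graph_def represented_graph_def)
    show ?thesis using grundy_domination_number_eq legal_dominating_scan_result by blast
  qed
  then show ?thesis
    unfolding grundy_dominating_seq_def length_scan_result by (intro conjI allI impI) (elim conjE, simp)+
qed

end
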